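(* Let $R$ be a non-zero ring with unity whose characteristic $\operatorname{char} R$ is positive, let $M$ be a finite $R$-module with $m=|M|$, and suppose $m$ is a multiple of $\operatorname{char} R$. Let $A,B$ be non-empty subsets of $R$. Then $C_{A,B}(M)\leq m^2$ and $E_{A,B}(M)\leq 2m-1$.
   Context: A sequence of length $k$ in a set $X$ is an element of $X^k$; a subsequence is a non-empty subfamily of terms taken in the original order, and a subsequence having consecutive terms is one of the form $(x_i,x_{i+1},\ldots,x_j)$. A sequence $(x_1,\ldots,x_k)$ in $M$ is an $(A,B)$-weighted zero-sum sequence if there exist $a_1,\ldots,a_k\in A$ and $b_1,\ldots,b_k\in B$ with $a_1x_1+\cdots+a_kx_k=0$ and $b_1a_1+\cdots+b_ka_k=0$. $C_{A,B}(M)$ is the least positive integer $k$ such that every sequence in $M$ of length $k$ has an $(A,B)$-weighted zero-sum subsequence having consecutive terms; $E_{A,B}(M)$ is the least positive integer $k$ such that every sequence in $M$ of length $k$ has an $(A,B)$-weighted zero-sum subsequence of length $|M|$. (The claim includes that these least integers exist.) *)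

theory Defs
  imports Complex_Main "HOL-Library.Cardinality" "HOL-Library.Sublist"
begin

text \<open>
  Unital left modules over a ring with unity that need not be commutative; the locale
  \<^locale>\<open>module\<close> of the library has the same axioms over a commutative ring.
\<close>

locale left_module =
  fixes scale :: "'r::ring_1 \<Rightarrow> 'm::ab_group_add \<Rightarrow> 'm"
  assumes scale_right_distrib: "scale a (x + y) = scale a x + scale a y"
    and scale_left_distrib: "scale (a + b) x = scale a x + scale b x"
    and scale_scale: "scale a (scale b x) = scale (a * b) x"
    and scale_one: "scale 1 x = x"

text \<open>
  A sequence in the module is a list, its subsequences are given by \<^const>\<open>subseq\<close>, and those
  having consecutive terms by \<^const>\<open>sublist\<close>. Both relations admit the empty list, which is
  not counted as a subsequence and is therefore excluded explicitly below.
\<close>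

definition weighted_zero_sum ::
  "('r::ring_1 \<Rightarrow> 'm::ab_group_add \<Rightarrow> 'm) \<Rightarrow> 'r set \<Rightarrow> 'r set \<Rightarrow> 'm list \<Rightarrow> bool" where
  "weighted_zero_sum scale A B xs \<longleftrightarrow>
     (\<exists>as bs. length as = length xs \<and> length bs = length xs \<and> set as \<subseteq> A \<and> set bs \<subseteq> B \<and>
        (\<Sum>i<length xs. scale (as ! i) (xs ! i)) = 0 \<and>
        (\<Sum>i<length xs. bs ! i * as ! i) = 0)"

definition C_property ::
  "('r::ring_1 \<Rightarrow> 'm::ab_group_add \<Rightarrow> 'm) \<Rightarrow> 'r set \<Rightarrow> 'r set \<Rightarrow> nat \<Rightarrow> bool" where
  "C_property scale A B k \<longleftrightarrow> k > 0 \<and>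
     (\<forall>xs. length xs = k \<longrightarrow>
        (\<exists>ys. sublist ys xs \<and> ys \<noteq> [] \<and> weighted_zero_sum scale A B ys))"

definition E_property ::
  "('r::ring_1 \<Rightarrow> 'm::{ab_group_add, finite} \<Rightarrow> 'm) \<Rightarrow> 'r set \<Rightarrow> 'r set \<Rightarrow> nat \<Rightarrow> bool" where
  "E_property scale A B k \<longleftrightarrow> k > 0 \<and>
     (\<forall>xs. length xs = k \<longrightarrow>
        (\<exists>ys. subseq ys xs \<and> ys \<noteq> [] \<and> length ys = CARD('m) \<and> weighted_zero_sum scale A B ys))"

text \<open>
  The two constants are meaningful only if some \<open>k\<close> has the respective property, since
  \<^const>\<open>Least\<close> is unspecified otherwise.
\<close>

definition C_const ::
  "('r::ring_1 \<Rightarrow> 'm::ab_group_add \<Rightarrow> 'm) \<Rightarrow> 'r set \<Rightarrow> 'r set \<Rightarrow> nat" where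
  "C_const scale A B = (LEAST k. C_property scale A B k)"

definition E_const ::
  "('r::ring_1 \<Rightarrow> 'm::{ab_group_add, finite} \<Rightarrow> 'm) \<Rightarrow> 'r set \<Rightarrow> 'r set \<Rightarrow> nat" where
  "E_const scale A B = (LEAST k. E_property scale A B k)"

end

theory Submission
  imports Defs
begin

text \<open>
  Fix \<open>a \<in> A\<close> and \<open>b \<in> B\<close>. With these constant weights every sequence that sums to zero and whose
  length is a multiple of \<open>m\<close>, hence of the characteristic, is a weighted zero-sum sequence, so only
  the finite abelian group \<open>M\<close> matters. Among the \<open>m\<^sup>2 + 1\<close> prefixes of a sequence of length
  \<open>m\<^sup>2\<close>, two agree in their sum and in their length modulo \<open>m\<close>; they enclose the required
  block. For the second constant one needs the Erdos-Ginzburg-Ziv theorem for finite abelian groups,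
  proved following Gao: translate so that \<open>0\<close> is the most frequent term, with multiplicity \<open>h\<close>.
  Any \<open>m\<close> terms contain a zero-sum subsequence of length at most \<open>h\<close>, by Scherk's bound
  \<open>|S + T| \<ge> |S| + |T| - 1\<close>. Collecting such subsequences from the nonzero terms yields a zero-sum
  subsequence of length between \<open>m - h\<close> and \<open>m\<close>, which is filled up with zeros.
\<close>

section \<open>Sumsets and short zero-sum subfamilies\<close>

text \<open>Induction on \<open>card T\<close>: the transform below keeps
  \<open>card S + card T\<close>, shrinks \<open>T\<close>, does not enlarge the sumset and
  preserves the hypothesis that 0 has only its trivial representation.\<close>

lemma scherk:
  fixes S T :: "'a::ab_group_add set"
  assumes "finite S" "finite T" "0 \<in> S" "0 \<in> T"
    and "\<And>s t. s \<in> S \<Longrightarrow> t \<in> T \<Longrightarrow> s + t = 0 \<Longrightarrow> s = 0"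
  shows "card S + card T \<le> card ((\<lambda>(s, t). s + t) ` (S \<times> T)) + 1"
  using assms
proof (induction "card T" arbitrary: S T rule: less_induct)
  case less
  note uniq = less.prems(5)
  show ?case
  proof (cases "T = {0}")
    case True
    then show ?thesis by (auto simp: image_def)
  next
    case False
    then obtain t where t: "t \<in> T" "t \<noteq> 0" using less.prems(4) by blast
    \<comment> \<open>Otherwise translation by \<open>t\<close> would permute \<open>S\<close>, and
      0 would be a sum \<open>s + t\<close> with \<open>t\<close> nonzero.\<close>
    have "\<exists>e\<in>S. \<not> (+) e ` T \<subseteq> S"
    proof (rule ccontr)
      assume "\<not> ?thesis"
      then have "(\<lambda>s. s + t) ` S \<subseteq> S" using t by blast
      moreover have "inj_on (\<lambda>s. s + t) S" by (simp add: inj_on_def)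
      ultimately have "(\<lambda>s. s + t) ` S = S" by (rule endo_inj_surj[OF less.prems(1)])
      then obtain s where "s \<in> S" "s + t = 0" using less.prems(3) by (metis imageE)
      then show False using uniq[of s t] t by simp
    qed
    then obtain e where e: "e \<in> S" "\<not> (+) e ` T \<subseteq> S" by blast
    \<comment> \<open>Dyson's e-transform\<close>
    define S' where "S' = S \<union> (+) e ` T"
    define T' where "T' = {t \<in> T. e + t \<in> S}"
    have fin: "finite S'" "finite T'" using less.prems by (auto simp: S'_def T'_def)
    have "T' \<subset> T" using e by (auto simp: T'_def)
    then have lt: "card T' < card T" using less.prems(2) by (simp add: psubset_card_mono)
    have "S \<inter> (+) e ` T = (+) e ` T'" by (auto simp: T'_def)
    then have "card (S \<inter> (+) e ` T) = card T'" by (simp add: card_image)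
    moreover have "card ((+) e ` T) = card T" by (simp add: card_image)
    ultimately have card: "card S + card T = card S' + card T'"
      using card_Un_Int[of S "(+) e ` T"] less.prems by (simp add: S'_def)
    \<comment> \<open>If \<open>s = e + u\<close> is a new element, then
      \<open>(e + t) + u = 0\<close> has its first summand in \<open>S\<close>; uniqueness applies
      to this sum and then to \<open>e + t = 0\<close>.\<close>
    have "s = 0" if st: "s \<in> S'" "t \<in> T'" "s + t = 0" for s t
    proof (cases "s \<in> S")
      case True
      then show ?thesis using that uniq by (auto simp: T'_def)
    next
      case False
      then obtain u where u: "u \<in> T" "s = e + u" using st by (auto simp: S'_def)
      then have "(e + t) + u = 0" using that by (simp add: algebra_simps)
      then have "e + t = 0" using uniq[of "e + t" u] that u by (simp add: T'_def)
      then have "e = 0" using uniq[of e t] that e by (simp add: T'_def)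
      then show ?thesis using \<open>e + t = 0\<close> that by simp
    qed
    moreover have "0 \<in> S'" "0 \<in> T'" using less.prems e by (auto simp: S'_def T'_def)
    ultimately have "card S' + card T' \<le> card ((\<lambda>(s, t). s + t) ` (S' \<times> T')) + 1"
      using less.hyps[OF lt fin] by blast
    also have "(\<lambda>(s, t). s + t) ` (S' \<times> T') \<subseteq> (\<lambda>(s, t). s + t) ` (S \<times> T)"
    proof -
      have "s + t \<in> (\<lambda>(s, t). s + t) ` (S \<times> T)" if st: "s \<in> S'" "t \<in> T'" for s t
      proof (cases "s \<in> S")
        case True
        then show ?thesis using that by (auto simp: T'_def)
      next
        case False
        then obtain u where "u \<in> T" "s = e + u" using st by (auto simp: S'_def)
        \<comment> \<open>The shift \<open>e\<close> moves to the other summand;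
          \<open>e + t\<close> lies in \<open>S\<close> by the choice of \<open>T'\<close>.\<close>
        then have "s + t = (e + t) + u" "(e + t, u) \<in> S \<times> T"
          using that by (auto simp: T'_def algebra_simps)
        then show ?thesis by (metis (no_types, lifting) case_prod_conv image_eqI)
      qed
      then show ?thesis by auto
    qed
    then have "card ((\<lambda>(s, t). s + t) ` (S' \<times> T')) \<le> card ((\<lambda>(s, t). s + t) ` (S \<times> T))"
      using less.prems by (intro card_mono) auto
    finally show ?thesis using card by simp
  qed
qed

text \<open>Without such a \<open>K\<close>, sums with at most one term from each of
  \<open>h\<close> classes of distinct terms would take more than \<open>CARD('m)\<close> values,
  since by \<open>scherk\<close> each class adds at least its size.\<close>

lemma short_zero_sum:
  fixes f :: "nat \<Rightarrow> 'm::{ab_group_add, finite}"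
  assumes fin: "finite I" and card: "CARD('m) \<le> card I"
    and mult: "\<And>x. card {i \<in> I. f i = x} \<le> h"
  shows "\<exists>K\<subseteq>I. K \<noteq> {} \<and> card K \<le> h \<and> sum f K = 0"
proof (rule ccontr)
  assume neg: "\<not> ?thesis"
  \<comment> \<open>The fibres of \<open>c\<close> split the family into \<open>h\<close> sets of distinct terms.\<close>
  define c where "c i = card {j \<in> I. j < i \<and> f j = f i}" for i
  have c_less: "c i < h" if "i \<in> I" for i
  proof -
    have "{j \<in> I. j < i \<and> f j = f i} \<subset> {j \<in> I. f j = f i}" using that by blast
    then have "c i < card {j \<in> I. f j = f i}"
      unfolding c_def using fin by (intro psubset_card_mono) auto
    then show ?thesis using mult[of "f i"] by simp
  qed
  have c_mono: "c i < c j" if "i \<in> I" "f i = f j" "i < j" for i j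
    unfolding c_def using that fin by (intro psubset_card_mono) auto
  have f_inj: "i = j" if "i \<in> I" "j \<in> I" "c i = c j" "f i = f j" for i j
    using that c_mono[of i j] c_mono[of j i] by (metis less_irrefl linorder_neqE_nat)
  \<comment> \<open>The values of \<open>c\<close> lie below \<open>h\<close>, so a set on which
    \<open>c\<close> is injective is small enough for \<open>neg\<close> to apply.\<close>
  have nz: "K = {}" if "K \<subseteq> I" "inj_on c K" "sum f K = 0" for K
  proof -
    have "finite K" using that fin finite_subset by blast
    have "card K = card (c ` K)" using that by (simp add: card_image)
    also have "\<dots> \<le> card {..<h}" using that c_less by (intro card_mono) auto
    finally have "card K \<le> h" by simp
    then show ?thesis using neg that by blast
  qed
  \<comment> \<open>These sums take at most one term from each of the first \<open>k\<close> fibres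
    of \<open>c\<close>; the empty choice contributes 0.\<close>
  define \<Sigma> where "\<Sigma> k = sum f ` {K. K \<subseteq> I \<and> inj_on c K \<and> c ` K \<subseteq> {..<k}}" for k
  have "card {i \<in> I. c i < k} + 1 \<le> card (\<Sigma> k)" for k
  proof (induction k)
    case 0
    have "{K. K \<subseteq> I \<and> inj_on c K \<and> c ` K \<subseteq> {..<0}} = {{}}" by auto
    then have "\<Sigma> 0 = {0}" by (simp add: \<Sigma>_def)
    then show ?case by simp
  next
    case (Suc k)
    define J where "J = {i \<in> I. c i = k}"
    \<comment> \<open>The added 0 stands for taking no term from fibre \<open>k\<close>. It is not a
      value of \<open>f\<close> on \<open>J\<close>, so it makes up for the 1 lost in
      \<open>scherk\<close>.\<close>
    define T where "T = insert 0 (f ` J)"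
    have "finite J" using fin by (simp add: J_def)
    have "f j \<noteq> 0" if "j \<in> J" for j using nz[of "{j}"] that by (auto simp: J_def)
    then have "0 \<notin> f ` J" by force
    moreover have "inj_on f J" using f_inj by (auto simp: J_def inj_on_def)
    ultimately have cT: "card T = card J + 1"
      using \<open>finite J\<close> by (simp add: T_def card_image)
    have ext: "insert j K \<subseteq> I" "inj_on c (insert j K)" "c ` insert j K \<subseteq> {..<Suc k}"
      "sum f (insert j K) = f j + sum f K"
      if "K \<subseteq> I" "inj_on c K" "c ` K \<subseteq> {..<k}" "j \<in> J" for j K
    proof -
      have "c j = k" "j \<in> I" using that by (simp_all add: J_def)
      moreover have less: "c i < k" if "i \<in> K" for i using that \<open>c ` K \<subseteq> {..<k}\<close> by blast
      ultimately have "c j \<notin> c ` K" by (metis imageE less_irrefl)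
      then have "j \<notin> K" by blast
      moreover have "finite K" using that fin finite_subset by blast
      ultimately show "sum f (insert j K) = f j + sum f K" by simp
      show "inj_on c (insert j K)" using \<open>c j \<notin> c ` K\<close> \<open>j \<notin> K\<close> that by simp
      show "insert j K \<subseteq> I" using \<open>j \<in> I\<close> that by simp
      show "c ` insert j K \<subseteq> {..<Suc k}" using \<open>c j = k\<close> less by (auto intro: less_SucI)
    qed
    \<comment> \<open>For \<open>t\<close> nonzero, the set \<open>insert j K\<close> would be a
      non-empty zero-sum choice, which \<open>nz\<close> excludes.\<close>
    have uniq: "s = 0" if st: "s \<in> \<Sigma> k" "t \<in> T" "s + t = 0" for s t
    proof (cases "t = 0")
      case False
      then obtain j where j: "j \<in> J" "t = f j" using st by (auto simp: T_def)
      obtain K where K: "K \<subseteq> I" "inj_on c K" "c ` K \<subseteq> {..<k}" "s = sum f K"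
        using st by (auto simp: \<Sigma>_def)
      have "insert j K = {}"
        using ext[OF K(1-3) j(1)] st(3) j K by (intro nz) (simp_all add: add.commute)
      then show ?thesis by simp
    qed (use st in simp)
    have "0 \<in> \<Sigma> k" unfolding \<Sigma>_def by (intro image_eqI[of _ _ "{}"]) simp_all
    moreover have "0 \<in> T" by (simp add: T_def)
    ultimately have "card (\<Sigma> k) + card T \<le> card ((\<lambda>(s, t). s + t) ` (\<Sigma> k \<times> T)) + 1"
      by (rule scherk[OF finite finite _ _ uniq])
    also have "(\<lambda>(s, t). s + t) ` (\<Sigma> k \<times> T) \<subseteq> \<Sigma> (Suc k)"
    proof -
      have "s + t \<in> \<Sigma> (Suc k)" if st: "s \<in> \<Sigma> k" "t \<in> T" for s t
      proof -
        obtain K where K: "K \<subseteq> I" "inj_on c K" "c ` K \<subseteq> {..<k}" "s = sum f K"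
          using st by (auto simp: \<Sigma>_def)
        consider "t = 0" | j where "j \<in> J" "t = f j" using st by (auto simp: T_def)
        then show ?thesis
        proof cases
          case 1
          have "c ` K \<subseteq> {..<Suc k}" using K(3) by force
          then show ?thesis using 1 K by (auto simp: \<Sigma>_def)
        next
          case 2
          then show ?thesis
            using ext[OF K(1-3) 2(1)] K(4) unfolding \<Sigma>_def
            by (intro image_eqI[of _ _ "insert j K"]) (simp_all add: add.commute)
        qed
      qed
      then show ?thesis by auto
    qed
    then have "card ((\<lambda>(s, t). s + t) ` (\<Sigma> k \<times> T)) \<le> card (\<Sigma> (Suc k))"
      by (intro card_mono) auto
    finally have "card (\<Sigma> k) + card J \<le> card (\<Sigma> (Suc k))" using cT by simp
    moreover have "{i \<in> I. c i < Suc k} = {i \<in> I. c i < k} \<union> J" by (auto simp: J_def)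
    then have "card {i \<in> I. c i < Suc k} = card {i \<in> I. c i < k} + card J"
      using fin by (simp add: card_Un_disjoint J_def disjoint_iff)
    ultimately show ?case using Suc.IH by simp
  qed
  moreover have "{i \<in> I. c i < h} = I" using c_less by blast
  ultimately have "card I + 1 \<le> card (\<Sigma> h)" by metis
  also have "\<dots> \<le> CARD('m)" by (intro card_mono) auto
  finally show False using card by simp
qed

section \<open>The Erdos-Ginzburg-Ziv theorem\<close>

text \<open>Translation by \<open>x\<close> permutes the group, so the sum of all elements does not
  change when \<open>x\<close> is added to each. This later undoes the translation by
  \<open>g\<close>.\<close>

lemma sum_const_card_UNIV:
  fixes x :: "'m::{ab_group_add, finite}"
  assumes "card K = CARD('m)"
  shows "(\<Sum>i\<in>K. x) = 0"
proof -
  have "finite K" using assms by (metis card.infinite zero_less_card_finite less_irrefl)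
  then obtain g where "bij_betw g K (UNIV :: 'm set)"
    using assms by (metis finite_same_card_bij finite)
  then have "(\<Sum>i\<in>K. x) = (\<Sum>y\<in>(UNIV :: 'm set). x)" by (rule sum.reindex_bij_betw)
  moreover have "(\<Sum>y\<in>UNIV. y + x) = (\<Sum>y\<in>(UNIV :: 'm set). y)"
    by (rule sum.reindex_bij_betw[of "\<lambda>y. y + x"]) (rule bij_plus_right)
  ultimately show ?thesis by (simp add: sum.distrib)
qed

theorem erdos_ginzburg_ziv:
  fixes f :: "nat \<Rightarrow> 'm::{ab_group_add, finite}"
  assumes fin: "finite I" and card: "2 * CARD('m) - 1 \<le> card I"
  obtains K where "K \<subseteq> I" "card K = CARD('m)" "sum f K = 0"
proof -
  let ?m = "CARD('m)"
  define \<mu> where "\<mu> x = card {i \<in> I. f i = x}" for x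
  define h where "h = Max (range \<mu>)"
  have le_h: "\<mu> x \<le> h" for x by (simp add: h_def)
  have "h \<in> range \<mu>" unfolding h_def by (rule Max_in) auto
  then obtain g where g: "\<mu> g = h" by blast
  define f' where "f' i = f i - g" for i
  define Z where "Z = {i \<in> I. f i = g}"
  have cZ: "card Z = h" and finZ: "finite Z" using g fin by (simp_all add: \<mu>_def Z_def)
  \<comment> \<open>A longest zero-sum family among the nonzero translated terms is sought, short
    enough to be filled up with zeros.\<close>
  define P where "P L \<longleftrightarrow> L \<subseteq> I - Z \<and> card L \<le> ?m \<and> sum f' L = 0" for L
  have "P {}" by (simp add: P_def)
  moreover have "\<forall>L. P L \<longrightarrow> card L < ?m + 1" by (auto simp: P_def)
  ultimately obtain L where L: "P L" and max: "\<And>L'. P L' \<Longrightarrow> card L' \<le> card L"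
    using ex_has_greatest_nat[of P "{}" card "?m + 1"] by blast
  have finL: "finite L" using L fin by (auto simp: P_def intro: finite_subset)
  have "?m \<le> card L + h"
  proof (rule ccontr)
    assume less: "\<not> ?thesis"
    define T where "T = I - Z - L"
    have finT: "finite T" using fin by (simp add: T_def)
    have "I = Z \<union> L \<union> T" using L by (auto simp: T_def P_def Z_def)
    then have "card I \<le> card Z + card L + card T"
      by (metis card_Un_le add_le_mono1 order_trans)
    \<comment> \<open>At most \<open>?m - 1\<close> of the at least \<open>2 * ?m - 1\<close>
      indices lie in \<open>Z\<close> or \<open>L\<close>.\<close>
    then have "?m \<le> card T" using less card cZ by simp
    moreover have "card {i \<in> T. f' i = x} \<le> h" for x
    proof -
      have "card {i \<in> T. f' i = x} \<le> \<mu> (x + g)"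
        unfolding \<mu>_def using fin by (intro card_mono) (auto simp: T_def f'_def)
      then show ?thesis using le_h order_trans by blast
    qed
    ultimately have "\<exists>K\<subseteq>T. K \<noteq> {} \<and> card K \<le> h \<and> sum f' K = 0"
      by (rule short_zero_sum[OF finT])
    then obtain K where K: "K \<subseteq> T" "K \<noteq> {}" "card K \<le> h" "sum f' K = 0" by blast
    have finK: "finite K" using K finT finite_subset by blast
    have disj: "L \<inter> K = {}" using K by (auto simp: T_def)
    have cLK: "card (L \<union> K) = card L + card K" using card_Un_disjoint finL finK disj by blast
    \<comment> \<open>The length stays below \<open>?m\<close> because \<open>card K \<le> h\<close>
      and \<open>card L + h < ?m\<close>; this contradicts maximality of \<open>L\<close>.\<close>
    have "P (L \<union> K)"
      using L K cLK less sum.union_disjoint[OF finL finK disj, of f'] by (auto simp: P_def T_def)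
    then have "card K = 0" using max[of "L \<union> K"] cLK by simp
    then show False using K finK by simp
  qed
  then obtain Z' where Z': "Z' \<subseteq> Z" "card Z' = ?m - card L"
    using cZ by (metis le_diff_conv add.commute obtain_subset_with_card_n)
  have finZ': "finite Z'" using Z' finZ finite_subset by blast
  have disj: "L \<inter> Z' = {}" using L Z' by (auto simp: P_def)
  have "card (L \<union> Z') = ?m"
    using card_Un_disjoint[OF finL finZ' disj] Z' L by (simp add: P_def)
  moreover have "sum f' Z' = 0" using Z' by (intro sum.neutral) (auto simp: Z_def f'_def)
  then have "sum f' (L \<union> Z') = 0"
    using sum.union_disjoint[OF finL finZ' disj, of f'] L by (simp add: P_def)
  then have "sum f (L \<union> Z') = (\<Sum>i\<in>L \<union> Z'. g)" by (simp add: f'_def sum_subtractf)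
  moreover have "L \<union> Z' \<subseteq> I" using L Z' by (auto simp: P_def Z_def)
  ultimately show thesis using that sum_const_card_UNIV by metis
qed

section \<open>From zero sums to weighted zero sums\<close>

text \<open>Translates index sets into subsequences. Reverse induction is used because appending a
  term leaves the earlier indices unchanged.\<close>

lemma sum_list_nths:
  "sum_list (nths xs K) = (\<Sum>i | i < length xs \<and> i \<in> K. xs ! i)"
  for xs :: "'a::comm_monoid_add list"
proof (induction xs rule: rev_induct)
  case (snoc x xs)
  have "{i. i < Suc (length xs) \<and> i \<in> K} =
      (if length xs \<in> K then insert (length xs) else id) {i. i < length xs \<and> i \<in> K}"
    by (auto simp: less_Suc_eq)
  then show ?case using snoc by (simp add: nths_append nth_append add.commute)
qed simp

text \<open>The constant weight \<open>a\<close> factors out of the first sum; the second is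
  \<open>b * a\<close> times the length, which vanishes in the ring.\<close>

lemma weighted_zero_sum_const:
  fixes scale :: "'r::ring_1 \<Rightarrow> 'm::ab_group_add \<Rightarrow> 'm"
  assumes "left_module scale" and "a \<in> A" "b \<in> B"
    and "sum_list ys = 0" and "CHAR('r) dvd length ys"
  shows "weighted_zero_sum scale A B ys"
proof -
  interpret left_module scale by fact
  let ?n = "length ys"
  interpret additive "scale a" by standard (rule scale_right_distrib)
  have "(\<Sum>i<?n. scale a (ys ! i)) = scale a (\<Sum>i<?n. ys ! i)" by (simp add: sum)
  also have "(\<Sum>i<?n. ys ! i) = 0" using assms(4) by (simp add: sum_list_sum_nth atLeast0LessThan)
  finally have "(\<Sum>i<?n. scale (replicate ?n a ! i) (ys ! i)) = 0" by (simp add: zero)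
  moreover have "(of_nat ?n :: 'r) = 0" using assms(5) by (simp add: of_nat_eq_0_iff_char_dvd)
  then have "(\<Sum>i<?n. replicate ?n b ! i * replicate ?n a ! i) = 0" by simp
  ultimately show ?thesis unfolding weighted_zero_sum_def
    using assms(2,3) by (intro exI[of _ "replicate ?n a"] exI[of _ "replicate ?n b"]) auto
qed

lemma zero_sum_block:
  fixes xs :: "'m::{ab_group_add, finite} list"
  assumes "length xs = CARD('m)\<^sup>2"
  obtains ys where "sublist ys xs" "ys \<noteq> []" "sum_list ys = 0" "CARD('m) dvd length ys"
proof -
  let ?m = "CARD('m)"
  define p where "p i = (sum_list (take i xs), i mod ?m)" for i
  have "p ` {..length xs} \<subseteq> UNIV \<times> {..<?m}" by (auto simp: p_def)
  then have "card (p ` {..length xs}) \<le> card ((UNIV :: 'm set) \<times> {..<?m})"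
    by (intro card_mono) auto
  \<comment> \<open>Counting the empty prefix, there is one prefix more than there are possible
    values of \<open>p\<close>.\<close>
  then have "\<not> inj_on p {..length xs}"
    using assms by (intro pigeonhole) (simp add: power2_eq_square)
  then obtain i j where ij: "i < j" "j \<le> length xs" "p i = p j"
    by (metis inj_on_def atMost_iff linorder_neqE_nat)
  define ys where "ys = drop i (take j xs)"
  have split: "take j xs = take i xs @ ys"
    using ij unfolding ys_def by (metis append_take_drop_id min.absorb1 less_imp_le take_take)
  have len: "length ys = j - i" using ij by (simp add: ys_def)
  have "xs = take i xs @ ys @ drop j xs" using split by (metis append_assoc append_take_drop_id)
  then have "sublist ys xs" by (metis sublist_appendI)
  moreover have "ys \<noteq> []" using len ij by auto
  moreover have "sum_list ys = 0" using ij(3) split by (simp add: p_def)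
  moreover have "?m dvd length ys"
    using ij(1) ij(3)[symmetric] len mod_eq_dvd_iff_nat[of i j ?m] by (simp add: p_def)
  ultimately show thesis using that by blast
qed

theorem theorem1:
  fixes scale :: "'r::ring_1 \<Rightarrow> 'm::{ab_group_add, finite} \<Rightarrow> 'm"
    and A B :: "'r set"
  assumes "left_module scale"
    and "CHAR('r) > 0"
    and "CHAR('r) dvd CARD('m)"
    and "A \<noteq> {}" and "B \<noteq> {}"
  shows "(\<exists>k. C_property scale A B k) \<and> C_const scale A B \<le> CARD('m) ^ 2 \<and>
         (\<exists>k. E_property scale A B k) \<and> E_const scale A B \<le> 2 * CARD('m) - 1"
proof -
  let ?m = "CARD('m)"
  have m: "?m > 0" by simp
  obtain a b where ab: "a \<in> A" "b \<in> B" using assms(4,5) by blast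
  have weighted: "weighted_zero_sum scale A B ys" if "sum_list ys = 0" "?m dvd length ys" for ys
    using weighted_zero_sum_const[OF assms(1) ab that(1)] assms(3) that(2) dvd_trans by blast
  have C: "C_property scale A B (?m ^ 2)"
    unfolding C_property_def using m weighted by (auto elim!: zero_sum_block)
  have E: "E_property scale A B (2 * ?m - 1)"
    unfolding E_property_def
  proof (intro conjI allI impI)
    show "0 < 2 * ?m - 1" using m by linarith
    fix xs :: "'m list"
    assume len: "length xs = 2 * ?m - 1"
    obtain K where K: "K \<subseteq> {..<length xs}" "card K = ?m" "(\<Sum>i\<in>K. xs ! i) = 0"
      using erdos_ginzburg_ziv[of "{..<length xs}" "(!) xs"] len by auto
    have eq: "{i. i < length xs \<and> i \<in> K} = K" using K(1) by auto
    have "length (nths xs K) = ?m" using K(2) by (simp add: length_nths eq)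
    moreover from this have "nths xs K \<noteq> []" using m by (metis list.size(3) less_irrefl)
    moreover have "sum_list (nths xs K) = 0" using K(3) by (simp add: sum_list_nths eq)
    ultimately show "\<exists>ys. subseq ys xs \<and> ys \<noteq> [] \<and> length ys = ?m \<and> weighted_zero_sum scale A B ys"
      using weighted subseq_conv_nths by (metis dvd_refl)
  qed
  show ?thesis unfolding C_const_def E_const_def using C E by (auto intro: Least_le)
qed

end
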